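(* Consider the recursive mixture algorithm on $\mathcal K$ described in the context, with final decisions $x_t$; it uses no a priori knowledge of the horizon $T$ or of the path variation of any comparator. There is a constant $C_d$ such that, for every $T\ge1$, every sequence of convex functions $f_1,\dots,f_T:\mathcal K\to\mathbb R$ with subgradients $g_t\in\partial f_t(x_t)$ received at the algorithm's decisions $x_t$, and every comparator sequence $x_1^*,\dots,x_T^*\in\mathcal K$ with $\sum_{t=1}^{T-1}\|x_{t+1}^*-x_t^*\|\le P$, the dynamic regret of this algorithm satisfies $$\sum_{t=1}^T\bigl(f_t(x_t)-f_t(x_t^* )\bigr)\le C_d\sqrt{D\,(P+D)\sum_{t=1}^T\|g_t\|^2}.$$ The guarantee holds simultaneously for all comparator sequences, each with its own $P$.
   Context: $\mathcal K\subset\mathbb R^N$ is a nonempty convex, closed and bounded set with diameter $D=\sup_{x,v\in\mathcal K}\|x-v\|>0$; $\|\cdot\|$ is the Euclidean norm and $\mathrm{Proj}_{\mathcal K}(x)=\arg\min_{v\in\mathcal K}\|x-v\|^2$. For convex $f:\mathcal K\to\mathbb R$, $\partial f(x)$ is the set of $g\in\mathbb R^N$ with $f(x)-f(v)\le g^\top(x-v)$ for all $v\in\mathcal K$. Runs. For $m=1,2,\dots$ the $m$-th run produces decisions $x_t^m\in\mathcal K$ by projected subgradient steps driven by the common subgradients $g_t\in\partial f_t(x_t)$, where $x_t$ is the final decision of the whole algorithm: $x_{t+1}^m=\mathrm{Proj}_{\mathcal K}(x_t^m-\eta_t^m g_t)$ if $g_t\ne0$ and $x_{t+1}^m=x_t^m$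 otherwise. All runs start from the same point. With $t_k=2^k-1$ for $0\le k\le m-1$, run $m$ is reset (its accumulated squared subgradient norms restarted from zero) following each round $t_k$, $1\le k\le m-1$, and it is not reset afterwards; in its $k$-th segment ($t_{k-1}<t\le t_k$ for $k\le m-1$; $t>t_{m-1}$ for $k=m$) it uses $\eta_t^m=D\sqrt{P_k/D+1/2}\,\bigl(\sum_{\tau=t_{k-1}+1}^t\|g_\tau\|^2\bigr)^{-1/2}$ with $P_k=D(2^{k-1}-1)$. Thus runs $m$ and $m'>m$ coincide until run $m'$ is reset following round $2^m-1$, so at each round $t$ only $O(\log t)$ runs are distinct. Recursive mixture. For $k\ge1$, $x_t^{(k-1)}=p_{t,k}x_t^k+p_{t,(k)}x_t^{(k)}$ is the convex combination of the two experts $x_t^k$ and $x_t^{(k)}$, with nonnegative weights $p_{t,k}+p_{t,(k)}=1$ produced causally by the two-expert mixing method below. Each mixing takes effect from the round at which its experts branch out: when all runs $k,k+1,\dots$ coincide up to round $t$, $x_t^{(k-1)}=x_t^k$ (so the recursion is finite at each round). The final decision is $x_t=x_t^{(0)}$. Two-expert mixing method. It is the second-order prediction-with-expert-advice method of Cesa-Bianchi, Mansour and Stoltz ("Improved second-order bounds for prediction with expert advice"), applied with two experts to the linear losses $l_{t,k}=g_t^\top x_t^k$ and $l_{t,(k)}=g_t^\top x_t^{(k)}$, and modified to use only one-sided losses, i.e. the nonnegative quantities $l_{t,k}-u_t$ and $l_{t,(k)}-u_t$ with $u_t=\min(l_{t,k},l_{t,(k)})$, with correspondingly simplified learning rates.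 In this form its regret against each of the two experts, $\sum_{t=1}^T g_t^\top(x_t^{(k-1)}-x_t^k)$ and $\sum_{t=1}^T g_t^\top(x_t^{(k-1)}-x_t^{(k)})$, is $$O\Bigl(\sqrt{\textstyle\sum_{t=1}^T\bigl[p_{t,k}(l_{t,k}-u_t)^2+p_{t,(k)}(l_{t,(k)}-u_t)^2\bigr]}\Bigr).$$ *)

theory Defs
  imports "HOL-Analysis.Analysis"
begin

definition subdifferential :: "'a::real_inner set \<Rightarrow> ('a \<Rightarrow> real) \<Rightarrow> 'a \<Rightarrow> 'a set" where
  "subdifferential K f x = {g. \<forall>v\<in>K. f x - f v \<le> g \<bullet> (x - v)}"


section \<open>The runs\<close>

text \<open>Rounds and runs are numbered from 1. Throughout, \<open>g\<close> is the sequence of subgradients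
  received by the whole algorithm.\<close>

definition reset_time :: "nat \<Rightarrow> nat" where
  "reset_time k = 2 ^ k - 1"

text \<open>For \<open>t \<ge> 1\<close> and \<open>m \<ge> 1\<close>: the \<open>k \<le> m - 1\<close> with
  \<open>reset_time (k - 1) < t \<le> reset_time k\<close>, and \<open>m\<close> if \<open>t > reset_time (m - 1)\<close>.\<close>

definition segment :: "nat \<Rightarrow> nat \<Rightarrow> nat" where
  "segment m t = (LEAST k. k = m \<or> t \<le> reset_time k)"

definition path_budget :: "real \<Rightarrow> nat \<Rightarrow> real" where
  "path_budget D k = D * (2 ^ (k - 1) - 1)"

definition step_size :: "real \<Rightarrow> (nat \<Rightarrow> 'a::real_normed_vector) \<Rightarrow> nat \<Rightarrow> nat \<Rightarrow> real" where
  "step_size D g m t =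
     (let k = segment m t in
        D * sqrt (path_budget D k / D + 1 / 2)
          / sqrt (\<Sum>\<tau> = reset_time (k - 1) + 1..t. (norm (g \<tau>))\<^sup>2))"

text \<open>A reset only restarts the accumulated squared norms; the iterate is kept. The value at
  round 0 is a dummy.\<close>

primrec run :: "'a::euclidean_space set \<Rightarrow> 'a \<Rightarrow> (nat \<Rightarrow> 'a) \<Rightarrow> nat \<Rightarrow> nat \<Rightarrow> 'a" where
  "run K x1 g m 0 = x1"
| "run K x1 g m (Suc t) =
     (if t = 0 then x1
      else if g t = 0 then run K x1 g m t
      else closest_point K (run K x1 g m t - step_size (diameter K) g m t *\<^sub>R g t))"


section \<open>Mixing two experts\<close>

definition excess :: "(nat \<Rightarrow> real) \<Rightarrow> (nat \<Rightarrow> real) \<Rightarrow> nat \<Rightarrow> real" where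
  "excess a b t = a t - min (a t) (b t)"

text \<open>The weight at round \<open>t\<close> of the expert with losses \<open>a\<close> against the expert with losses \<open>b\<close>.
  The algorithm of Cesa-Bianchi, Mansour and Stoltz plays exponential weights with rate
  \<open>min {1 / E\<^sub>t\<^sub>-\<^sub>1, c * sqrt (ln N / V\<^sub>t\<^sub>-\<^sub>1)}\<close>, where \<open>E\<^sub>t\<^sub>-\<^sub>1\<close> bounds the past loss ranges and
  \<open>V\<^sub>t\<^sub>-\<^sub>1\<close> is the cumulative variance of the losses under the weights played so far. Here
  \<open>N = 2\<close>, losses are replaced by the nonnegative one-sided ones, \<open>V\<^sub>t\<^sub>-\<^sub>1\<close> is their cumulative
  second moment, and the range term, needed only for losses of either sign, disappears.

  \<open>V = 0\<close> holds only while all one-sided losses have been 0; then \<open>\<eta> = 0\<close> by the convention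
  \<open>x / 0 = 0\<close>, and the weight is 1/2, as it would be for any other \<open>\<eta>\<close>.\<close>

fun mix_weight :: "real \<Rightarrow> (nat \<Rightarrow> real) \<Rightarrow> (nat \<Rightarrow> real) \<Rightarrow> nat \<Rightarrow> real" where
  "mix_weight c a b t =
     (let V = (\<Sum>s\<in>{1..<t}. mix_weight c a b s * (excess a b s)\<^sup>2
                          + (1 - mix_weight c a b s) * (excess b a s)\<^sup>2);
          \<eta> = c * sqrt (ln 2 / V);
          wa = exp (- \<eta> * (\<Sum>s\<in>{1..<t}. excess a b s));
          wb = exp (- \<eta> * (\<Sum>s\<in>{1..<t}. excess b a s))
      in wa / (wa + wb))"

declare mix_weight.simps [simp del]

text \<open>The weights are causal.\<close>

lemma mix_weight_cong [fundef_cong]: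
  assumes "c = c'" "t = t'"
    and "\<And>s. 0 < s \<Longrightarrow> s < t' \<Longrightarrow> a s = a' s"
    and "\<And>s. 0 < s \<Longrightarrow> s < t' \<Longrightarrow> b s = b' s"
  shows "mix_weight c a b t = mix_weight c' a' b' t'"
  using assms
proof (induction t arbitrary: t' rule: less_induct)
  case (less t)
  have c: "c' = c" and t: "t' = t"
    using less.prems(1,2) by simp_all
  have e: "excess a b s = excess a' b' s" "excess b a s = excess b' a' s"
    and w: "mix_weight c a b s = mix_weight c a' b' s" if "s \<in> {1..<t}" for s
    using that less.prems(3,4) less.IH[of s s] c t by (auto simp: excess_def)
  have sums: "(\<Sum>s\<in>{1..<t}. excess a b s) = (\<Sum>s\<in>{1..<t}. excess a' b' s)"
    "(\<Sum>s\<in>{1..<t}. excess b a s) = (\<Sum>s\<in>{1..<t}. excess b' a' s)"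
    "(\<Sum>s\<in>{1..<t}. mix_weight c a b s * (excess a b s)\<^sup>2
                     + (1 - mix_weight c a b s) * (excess b a s)\<^sup>2)
     = (\<Sum>s\<in>{1..<t}. mix_weight c a' b' s * (excess a' b' s)\<^sup>2
                     + (1 - mix_weight c a' b' s) * (excess b' a' s)\<^sup>2)"
    by (simp_all only: e w cong: sum.cong)
  show ?case
    unfolding c t
    by (subst (1 2) mix_weight.simps) (simp only: sums)
qed


section \<open>The recursive mixture\<close>

definition runs_coincide ::
  "'a::euclidean_space set \<Rightarrow> 'a \<Rightarrow> (nat \<Rightarrow> 'a) \<Rightarrow> nat \<Rightarrow> nat \<Rightarrow> bool" where
  "runs_coincide K x1 g k t \<longleftrightarrow> (\<forall>j\<ge>k. \<forall>s\<le>t. run K x1 g j s = run K x1 g k s)"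

lemma segment_eq:
  assumes "k \<le> j" "t \<le> reset_time k"
  shows "segment j t = segment k t"
proof -
  let ?i = "LEAST i. t \<le> reset_time i"
  have i: "t \<le> reset_time ?i" "?i \<le> k"
    using assms(2) by (auto intro: LeastI Least_le)
  have "segment n t = ?i" if "k \<le> n" for n
    unfolding segment_def
    by (rule Least_equality) (use i that in \<open>auto intro: Least_le\<close>)
  then show ?thesis
    using assms(1) by simp
qed

lemma run_eq:
  assumes "k \<le> j" "t \<le> 2 ^ k"
  shows "run K x1 g j t = run K x1 g k t"
  using assms(2)
proof (induction t)
  case (Suc t)
  then have "t \<le> reset_time k"
    by (simp add: reset_time_def)
  then have "segment j t = segment k t"
    using assms(1) by (rule segment_eq[rotated])
  then show ?case
    using Suc by (simp add: step_size_def)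
qed simp

lemma not_runs_coincide_less:
  assumes "\<not> runs_coincide K x1 g k t"
  shows "k < t"
proof (rule ccontr)
  assume "\<not> k < t"
  then have "t \<le> 2 ^ k"
    using less_exp[of k] by linarith
  then have "run K x1 g j s = run K x1 g k s" if "k \<le> j" "s \<le> t" for j s
    using that by (intro run_eq) simp_all
  then show False
    using assms unfolding runs_coincide_def by blast
qed

text \<open>\<open>mixture c K x1 g k t\<close> is the expert \<open>x\<^sub>t\<close> with superscript \<open>(k)\<close>, which mixes run
  \<open>k + 1\<close> with the expert of superscript \<open>(k + 1)\<close>. Rounds before the branching contribute
  nothing to the weight, because both experts have the same loss there.\<close>

function mixture ::
  "real \<Rightarrow> 'a::euclidean_space set \<Rightarrow> 'a \<Rightarrow> (nat \<Rightarrow> 'a) \<Rightarrow> nat \<Rightarrow> nat \<Rightarrow> 'a" where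
  "mixture c K x1 g k t =
     (if runs_coincide K x1 g (Suc k) t then run K x1 g (Suc k) t
      else let p = mix_weight c (\<lambda>s. g s \<bullet> run K x1 g (Suc k) s)
                                (\<lambda>s. g s \<bullet> mixture c K x1 g (Suc k) s) t
           in p *\<^sub>R run K x1 g (Suc k) t + (1 - p) *\<^sub>R mixture c K x1 g (Suc k) t)"
  by pat_completeness auto
termination
proof (relation "Wellfounded.measure (\<lambda>(c, K, x1, g, k, t). t - k)", goal_cases)
  case (2 c K x1 g k t s)
  then show ?case
    using not_runs_coincide_less[OF 2(1)] by simp
next
  case (3 c K x1 g k t)
  show ?case
    using not_runs_coincide_less[OF 3(1)] by simp
qed simp

declare mixture.simps [simp del]

definition decision ::
  "real \<Rightarrow> 'a::euclidean_space set \<Rightarrow> 'a \<Rightarrow> (nat \<Rightarrow> 'a) \<Rightarrow> nat \<Rightarrow> 'a" where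
  "decision c K x1 g t = mixture c K x1 g 0 t"

text \<open>The algorithm is causal: the decision of round \<open>t\<close> is determined by the subgradients of
  the earlier rounds.\<close>

lemma run_causal:
  assumes "\<And>s. 0 < s \<Longrightarrow> s < t \<Longrightarrow> g s = g' s"
  shows "run K x1 g m t = run K x1 g' m t"
  using assms
proof (induction t)
  case (Suc t)
  have "step_size (diameter K) g m t = step_size (diameter K) g' m t"
    unfolding step_size_def Let_def using Suc.prems by (auto intro!: sum.cong arg_cong[where f = sqrt])
  then show ?case
    using Suc by simp
qed simp

lemma decision_causal:
  assumes "\<And>s. 0 < s \<Longrightarrow> s < t \<Longrightarrow> g s = g' s"
  shows "decision c K x1 g t = decision c K x1 g' t"
proof -
  have "mixture c K x1 g k t = mixture c K x1 g' k t"
    if "\<And>s. 0 < s \<Longrightarrow> s < t \<Longrightarrow> g s = g' s" for k t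
    using that
  proof (induction c K x1 g k t rule: mixture.induct)
    case (1 c K x1 g k t)
    have r: "run K x1 g m s = run K x1 g' m s" if "s \<le> t" for m s
      using that "1.prems" by (intro run_causal) auto
    then have coinc: "runs_coincide K x1 g (Suc k) t = runs_coincide K x1 g' (Suc k) t"
      by (simp add: runs_coincide_def)
    show ?case
    proof (cases "runs_coincide K x1 g (Suc k) t")
      case True
      then show ?thesis
        using coinc r[of t] by (simp add: mixture.simps[of _ _ _ _ k])
    next
      case False
      have m: "mixture c K x1 g (Suc k) s = mixture c K x1 g' (Suc k) s" if "0 < s" "s \<le> t" for s
      proof (cases "s = t")
        case True
        then show ?thesis
          using "1.IH"(2)[OF False] "1.prems" by auto
      next
        case s: False
        then show ?thesis
          using "1.IH"(1)[OF False, of s] "1.prems" that by force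
      qed
      have "0 < t"
        using not_runs_coincide_less[OF False] by simp
      moreover have "mix_weight c (\<lambda>s. g s \<bullet> run K x1 g (Suc k) s)
              (\<lambda>s. g s \<bullet> mixture c K x1 g (Suc k) s) t
          = mix_weight c (\<lambda>s. g' s \<bullet> run K x1 g' (Suc k) s)
              (\<lambda>s. g' s \<bullet> mixture c K x1 g' (Suc k) s) t"
        by (rule mix_weight_cong) (use r m "1.prems" in auto)
      ultimately show ?thesis
        using False coinc r[of t] m[of t]
        by (simp add: mixture.simps[of _ _ _ _ k])
    qed
  qed
  then show ?thesis
    using assms by (simp add: decision_def)
qed

end

theory Submission
  imports Defs
begin

text \<open>Within segment \<open>k < m\<close> of run \<open>m\<close> a comparator has path length at most \<open>path_budget D k\<close>, for the
  trivial reason that the segment has \<open>2 ^ (k - 1)\<close> rounds; so the run is correctly tuned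
  there, and its regret in the segment is of order \<open>D * sqrt (2 ^ (k - 1) * S)\<close>, where \<open>S\<close> is the
  sum of the squared subgradient norms. For the least \<open>m\<close> whose last budget covers \<open>P\<close>, the power
  \<open>2 ^ m\<close> is of order \<open>(P + D) / D\<close>, and the regrets of its segments sum geometrically to the
  claimed bound. Descending from the final decision to run \<open>m\<close> passes through \<open>m\<close> mixtures, each
  costing only a constant times \<open>D * sqrt S\<close>, and \<open>m\<close> is of lower order than \<open>sqrt (2 ^ m)\<close>.

  For the mixtures the potential is the soft minimum of the two cumulative one-sided losses at the
  current rate. It increases when the rate decreases, and one round costs at most
  \<open>min (sqrt v) (\<eta> / 2 * v)\<close> above its increment, where \<open>v\<close> is the second moment of the round;
  the first alternative replaces any a priori bound on the range of the losses.\<close>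

section \<open>The two-expert mixture\<close>

text \<open>Up to a logarithm this is the power mean of \<open>exp (- x)\<close> and
  \<open>exp (- y)\<close> with exponent \<open>\<eta>\<close>. Averaging by 1/2, rather than just
  summing, gives monotonicity in \<open>\<eta>\<close> and the value 0 at the origin for every
  rate.\<close>

definition softmin :: "real \<Rightarrow> real \<Rightarrow> real \<Rightarrow> real" where
  "softmin \<eta> x y = - ln ((exp (- \<eta> * x) + exp (- \<eta> * y)) / 2) / \<eta>"

text \<open>Power means increase with the exponent. After both exponentials are divided by their
  mean \<open>m\<close>, this is the tangent-line bound
  \<open>z powr r \<le> r * z + (1 - r)\<close> for the concave power with
  \<open>r = \<eta>' / \<eta>\<close>, summed over two numbers of mean 1.\<close>

lemma softmin_antimono:
  assumes "0 < \<eta>'" "\<eta>' \<le> \<eta>"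
  shows "softmin \<eta> x y \<le> softmin \<eta>' x y"
proof -
  define r where "r = \<eta>' / \<eta>"
  define m where "m = (exp (- \<eta> * x) + exp (- \<eta> * y)) / 2"
  have r: "0 < r" "r \<le> 1" "\<eta>' = r * \<eta>" and m: "m > 0"
    using assms by (auto simp: r_def m_def add_pos_pos)
  have jensen: "exp (r * u) \<le> r * exp u + (1 - r)" for u :: real
    using convex_onD[OF exp_convex, where t = r and x = 0 and y = u] r by simp
  have shifted: "exp (- \<eta>' * z) = exp (r * (- \<eta> * z - ln m)) * exp (r * ln m)" for z
    by (simp add: r flip: exp_add) (simp add: algebra_simps)
  have norm1: "exp (- \<eta> * z - ln m) = exp (- \<eta> * z) / m" for z
    using m by (simp add: exp_diff)
  have "exp (r * (- \<eta> * x - ln m)) + exp (r * (- \<eta> * y - ln m))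
      \<le> r * ((exp (- \<eta> * x) + exp (- \<eta> * y)) / m) + 2 * (1 - r)"
    using jensen[of "- \<eta> * x - ln m"] jensen[of "- \<eta> * y - ln m"]
    unfolding norm1 by (simp add: add_divide_distrib distrib_left)
  also have "(exp (- \<eta> * x) + exp (- \<eta> * y)) / m = 2"
    using m by (simp add: m_def field_simps)
  finally have "exp (r * (- \<eta> * x - ln m)) + exp (r * (- \<eta> * y - ln m)) \<le> 2"
    by simp
  then have "(exp (- \<eta>' * x) + exp (- \<eta>' * y)) / 2 \<le> exp (r * ln m)"
    unfolding shifted by (simp flip: distrib_right)
  then have "ln ((exp (- \<eta>' * x) + exp (- \<eta>' * y)) / 2) \<le> r * ln m"
    by (subst (asm) ln_le_cancel_iff[symmetric]) (simp_all add: add_pos_pos)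
  then show ?thesis
    using assms r(1) unfolding softmin_def m_def[symmetric] r(3) by (simp add: field_simps)
qed

lemma softmin_le_left:
  assumes "\<eta> > 0"
  shows "softmin \<eta> x y \<le> x + ln 2 / \<eta>"
proof -
  have "ln (exp (- \<eta> * x) / 2) \<le> ln ((exp (- \<eta> * x) + exp (- \<eta> * y)) / 2)"
    by (subst ln_le_cancel_iff) (simp_all add: add_pos_pos)
  then have "- \<eta> * x - ln 2 \<le> ln ((exp (- \<eta> * x) + exp (- \<eta> * y)) / 2)"
    by (simp add: ln_div)
  then show ?thesis
    using assms by (simp add: softmin_def field_simps)
qed

lemma softmin_commute: "softmin \<eta> x y = softmin \<eta> y x"
  by (simp add: softmin_def add.commute)

lemma softmin_mono:
  assumes "\<eta> \<ge> 0" "x \<le> x'" "y \<le> y'"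
  shows "softmin \<eta> x y \<le> softmin \<eta> x' y'"
proof -
  have "ln ((exp (- \<eta> * x') + exp (- \<eta> * y')) / 2) \<le> ln ((exp (- \<eta> * x) + exp (- \<eta> * y)) / 2)"
    using assms by (subst ln_le_cancel_iff) (auto simp: add_pos_pos mult_left_mono intro!: add_mono)
  then show ?thesis
    using assms(1) unfolding softmin_def by (intro divide_right_mono) auto
qed

lemma softmin_zero [simp]: "softmin \<eta> 0 0 = 0"
  by (simp add: softmin_def)

text \<open>Here the one-sided losses pay off: no upper bound on \<open>x\<close> is required, so
  the learning rate needs no cap by the loss range.\<close>

lemma exp_neg_le_quadratic:
  fixes x :: real
  assumes "x \<ge> 0"
  shows "exp (- x) \<le> 1 - x + x\<^sup>2 / 2"
proof -
  have "(\<lambda>z. 1 - z + z\<^sup>2 / 2 - exp (- z)) 0 \<le> (\<lambda>z. 1 - z + z\<^sup>2 / 2 - exp (- z)) x"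
  proof (rule DERIV_nonneg_imp_nondecreasing[OF assms])
    fix z :: real
    have "((\<lambda>z. 1 - z + z\<^sup>2 / 2 - exp (- z)) has_real_derivative exp (- z) - (1 - z)) (at z)"
      by (auto intro!: derivative_eq_intros)
    moreover have "exp (- z) - (1 - z) \<ge> 0"
      using exp_ge_add_one_self[of "- z"] by simp
    ultimately show "\<exists>d. ((\<lambda>z. 1 - z + z\<^sup>2 / 2 - exp (- z)) has_real_derivative d) (at z) \<and> 0 \<le> d"
      by blast
  qed
  then show ?thesis by simp
qed

text \<open>At a fixed rate the increment is exactly \<open>- ln q / \<eta>\<close>, where
  \<open>q\<close> is the mean of the two new exponential factors under the played weights. The
  quadratic bound on each factor and \<open>ln q \<le> q - 1\<close> do the rest.\<close>

lemma softmin_step: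
  assumes "\<eta> > 0" "x \<ge> 0" "y \<ge> 0"
    and p: "p = exp (- \<eta> * A) / (exp (- \<eta> * A) + exp (- \<eta> * B))"
  shows "p * x + (1 - p) * y - \<eta> / 2 * (p * x\<^sup>2 + (1 - p) * y\<^sup>2)
    \<le> softmin \<eta> (A + x) (B + y) - softmin \<eta> A B"
proof -
  define S where "S = exp (- \<eta> * A) + exp (- \<eta> * B)"
  define q where "q = p * exp (- \<eta> * x) + (1 - p) * exp (- \<eta> * y)"
  have S: "S > 0"
    by (simp add: S_def add_pos_pos)
  have p': "p = exp (- \<eta> * A) / S" "1 - p = exp (- \<eta> * B) / S"
    using S by (auto simp: p S_def field_simps)
  then have p0: "p > 0" "1 - p > 0"
    using S by simp_all
  then have q: "q > 0"
    by (simp add: q_def add_pos_pos)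
  have "exp (- \<eta> * (A + x)) + exp (- \<eta> * (B + y)) = S * q"
    using S unfolding q_def p'(2) unfolding p'(1) by (simp add: distrib_left mult_exp_exp algebra_simps)
  then have step: "softmin \<eta> (A + x) (B + y) - softmin \<eta> A B = - ln q / \<eta>"
    unfolding softmin_def S_def[symmetric] using S q
    by (simp add: ln_div ln_mult_pos flip: diff_divide_distrib)
  have "q \<le> p * (1 - \<eta> * x + (\<eta> * x)\<^sup>2 / 2) + (1 - p) * (1 - \<eta> * y + (\<eta> * y)\<^sup>2 / 2)"
    unfolding q_def using p0 assms exp_neg_le_quadratic[of "\<eta> * x"] exp_neg_le_quadratic[of "\<eta> * y"]
    by (intro add_mono mult_left_mono) auto
  also have "\<dots> = 1 - \<eta> * (p * x + (1 - p) * y - \<eta> / 2 * (p * x\<^sup>2 + (1 - p) * y\<^sup>2))"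
    by (simp add: field_simps power2_eq_square)
  finally have "\<eta> * (p * x + (1 - p) * y - \<eta> / 2 * (p * x\<^sup>2 + (1 - p) * y\<^sup>2)) \<le> - ln q"
    using ln_le_minus_one[OF q] by linarith
  then show ?thesis
    unfolding step using assms(1) by (subst pos_le_divide_eq) (simp_all only: mult.commute)
qed

section \<open>Elementary inequalities for the cost of one round\<close>

lemma weighted_mean_le_sqrt:
  fixes p x y :: real
  assumes "0 \<le> p" "p \<le> 1"
  shows "p * x + (1 - p) * y \<le> sqrt (p * x\<^sup>2 + (1 - p) * y\<^sup>2)"
proof (rule real_le_rsqrt)
  have "p * x\<^sup>2 + (1 - p) * y\<^sup>2 - (p * x + (1 - p) * y)\<^sup>2 = p * (1 - p) * (x - y)\<^sup>2"
    by (simp add: algebra_simps power2_eq_square)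
  moreover have "\<dots> \<ge> 0"
    using assms by simp
  ultimately show "(p * x + (1 - p) * y)\<^sup>2 \<le> p * x\<^sup>2 + (1 - p) * y\<^sup>2"
    by linarith
qed

text \<open>The rate knows only the past moment \<open>V\<close>, and \<open>v / sqrt V\<close>
  alone does not telescope when \<open>v\<close> dwarfs \<open>V\<close>; the minimum with
  \<open>sqrt v\<close> repairs this. The 3 comes from \<open>Z + X \<le> 2 * X + Y\<close>, which
  is at most 3 times the larger of \<open>X\<close> and \<open>Y\<close>.\<close>

lemma min_le_sqrt_increment:
  fixes V v :: real
  assumes "V > 0" "v \<ge> 0"
  shows "min (sqrt v) (v / sqrt V) \<le> 3 * (sqrt (V + v) - sqrt V)"
proof -
  define X Y Z where "X = sqrt V" and "Y = sqrt v" and "Z = sqrt (V + v)"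
  have X: "X > 0" "Y \<ge> 0" and v: "v = Y\<^sup>2" "Z\<^sup>2 - X\<^sup>2 = Y\<^sup>2"
    using assms by (simp_all add: X_def Y_def Z_def)
  have Z: "Z \<le> X + Y" "X \<le> Z"
    using assms by (auto simp: X_def Y_def Z_def sqrt_add_le_add_sqrt)
  have "Y\<^sup>2 = (Z - X) * (Z + X)"
    using v by (simp add: power2_eq_square algebra_simps)
  also have "\<dots> \<le> (Z - X) * (2 * X + Y)"
    using Z by (intro mult_left_mono) auto
  finally have key: "Y\<^sup>2 \<le> (Z - X) * (2 * X + Y)" .
  show ?thesis
  proof (cases "X \<le> Y")
    case True
    have "Y * Y \<le> (Z - X) * (3 * Y)"
      using key mult_left_mono[of "2 * X + Y" "3 * Y" "Z - X"] True Z by (simp add: power2_eq_square)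
    then have "Y \<le> 3 * (Z - X)"
      using True X by (simp add: mult.commute mult.left_commute)
    then show ?thesis
      by (simp add: X_def Y_def Z_def)
  next
    case False
    have "v \<le> (3 * (Z - X)) * X"
      using key mult_left_mono[of "2 * X + Y" "3 * X" "Z - X"] False Z v by (simp add: algebra_simps)
    then have "v / X \<le> 3 * (Z - X)"
      using X by (simp add: pos_divide_le_eq)
    then show ?thesis
      by (simp add: X_def Z_def)
  qed
qed

section \<open>Second-order regret of the mixing method\<close>

definition mix_var :: "real \<Rightarrow> (nat \<Rightarrow> real) \<Rightarrow> (nat \<Rightarrow> real) \<Rightarrow> nat \<Rightarrow> real" where
  "mix_var c a b s = mix_weight c a b s * (excess a b s)\<^sup>2
                          + (1 - mix_weight c a b s) * (excess b a s)\<^sup>2"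

text \<open>The index counts observed rounds: the rate at \<open>n\<close> sets the weights of round
  \<open>Suc n\<close>.\<close>

definition mix_rate :: "real \<Rightarrow> (nat \<Rightarrow> real) \<Rightarrow> (nat \<Rightarrow> real) \<Rightarrow> nat \<Rightarrow> real" where
  "mix_rate c a b n = c * sqrt (ln 2 / (\<Sum>s=1..n. mix_var c a b s))"

lemma mix_weight_Suc:
  "mix_weight c a b (Suc n) =
    exp (- mix_rate c a b n * (\<Sum>s=1..n. excess a b s)) /
      (exp (- mix_rate c a b n * (\<Sum>s=1..n. excess a b s))
        + exp (- mix_rate c a b n * (\<Sum>s=1..n. excess b a s)))"
  by (subst mix_weight.simps)
    (simp only: mix_rate_def mix_var_def Let_def atLeastLessThanSuc_atLeastAtMost)

lemma mix_weight_bounds: "0 < mix_weight c a b t" "mix_weight c a b t < 1"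
  by (subst mix_weight.simps, simp add: Let_def add_pos_pos)+

lemma excess_nonneg: "excess a b t \<ge> 0"
  by (simp add: excess_def)

lemma mix_var_nonneg: "mix_var c a b t \<ge> 0"
  using mix_weight_bounds[where c = c and a = a and b = b and t = t] by (simp add: mix_var_def)

text \<open>Both weights are strictly positive, so a vanishing second moment forces both one-sided
  losses to vanish. This settles the rounds in which the rate is 0.\<close>

lemma mix_var_eq_0_iff: "mix_var c a b t = 0 \<longleftrightarrow> excess a b t = 0 \<and> excess b a t = 0"
  using mix_weight_bounds[where c = c and a = a and b = b and t = t]
  by (auto simp: mix_var_def add_nonneg_eq_0_iff)

text \<open>While the cumulative second moment is 0, the rate is 0 by division by zero; this is harmless,
  as both arguments of the soft minimum are then 0.\<close>

lemma mix_potential: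
  assumes "c > 0"
  shows "(\<Sum>s=1..n. mix_weight c a b s * excess a b s + (1 - mix_weight c a b s) * excess b a s)
    \<le> softmin (mix_rate c a b n) (\<Sum>s=1..n. excess a b s) (\<Sum>s=1..n. excess b a s)
      + (3 + 3 * c) * sqrt (\<Sum>s=1..n. mix_var c a b s)"
proof (induction n)
  case 0
  then show ?case by simp
next
  case (Suc n)
  define A B V where "A = (\<lambda>n. \<Sum>s=1..n. excess a b s)" and "B = (\<lambda>n. \<Sum>s=1..n. excess b a s)"
    and "V = (\<lambda>n. \<Sum>s=1..n. mix_var c a b s)"
  define L where "L = (\<lambda>n. \<Sum>s=1..n. mix_weight c a b s * excess a b s
    + (1 - mix_weight c a b s) * excess b a s)"
  define p v x y where "p = mix_weight c a b (Suc n)" and "v = mix_var c a b (Suc n)"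
    and "x = excess a b (Suc n)" and "y = excess b a (Suc n)"
  define \<eta> \<eta>' where "\<eta> = mix_rate c a b n" and "\<eta>' = mix_rate c a b (Suc n)"
  have Suc_eqs: "A (Suc n) = A n + x" "B (Suc n) = B n + y" "V (Suc n) = V n + v"
    "L (Suc n) = L n + (p * x + (1 - p) * y)"
    by (simp_all add: A_def B_def V_def L_def p_def v_def x_def y_def)
  have nonneg: "0 \<le> A n" "0 \<le> B n" "0 \<le> V n" "0 \<le> v" "0 \<le> x" "0 \<le> y"
    by (simp_all add: A_def B_def V_def v_def x_def y_def excess_nonneg mix_var_nonneg sum_nonneg)
  have p: "0 < p" "p < 1" "v = p * x\<^sup>2 + (1 - p) * y\<^sup>2"
    by (simp_all add: p_def mix_weight_bounds v_def x_def y_def mix_var_def)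
  have rates: "\<eta> = c * sqrt (ln 2 / V n)" "\<eta>' = c * sqrt (ln 2 / (V n + v))"
    using Suc_eqs(3) by (simp_all add: \<eta>_def \<eta>'_def mix_rate_def V_def)
  have mean: "p * x + (1 - p) * y \<le> sqrt v"
    unfolding p(3) using p(1,2) by (intro weighted_mean_le_sqrt) auto
  have \<eta>'0: "\<eta>' \<ge> 0"
    using assms nonneg by (simp add: rates)
  have "p * x + (1 - p) * y \<le> softmin \<eta>' (A n + x) (B n + y) - softmin \<eta> (A n) (B n)
      + (3 + 3 * c) * (sqrt (V n + v) - sqrt (V n))"
  proof (cases "V n = 0")
    \<comment> \<open>All earlier one-sided losses are 0, hence so is the old potential, and the
      whole round is charged to \<open>sqrt v\<close>.\<close>
    case True
    then have "\<forall>s\<in>{1..n}. mix_var c a b s = 0"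
      unfolding V_def by (subst (asm) sum_nonneg_eq_0_iff) (auto simp: mix_var_nonneg)
    then have AB: "A n = 0" "B n = 0"
      by (simp_all add: A_def B_def mix_var_eq_0_iff)
    have "0 \<le> softmin \<eta>' x y"
      using softmin_mono[OF \<eta>'0, of 0 x 0 y] nonneg by simp
    moreover have "sqrt v \<le> (3 + 3 * c) * sqrt v"
      using assms nonneg by (intro mult_le_cancel_right1[THEN iffD2]) auto
    ultimately show ?thesis
      using mean True AB by simp
  next
    case False
    then have V: "V n > 0" and \<eta>: "\<eta> > 0"
      using nonneg assms by (auto simp: rates)
    have \<eta>': "0 < \<eta>'" "\<eta>' \<le> \<eta>"
      using V assms nonneg unfolding rates
      by (auto intro!: mult_left_mono real_sqrt_le_mono divide_left_mono mult_pos_pos simp: add_pos_nonneg)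
    have mono: "softmin \<eta> (A n) (B n) \<le> softmin \<eta> (A n + x) (B n + y)"
      using nonneg \<eta> by (intro softmin_mono) auto
    have "p = exp (- \<eta> * A n) / (exp (- \<eta> * A n) + exp (- \<eta> * B n))"
      unfolding p_def \<eta>_def A_def B_def by (rule mix_weight_Suc)
    then have step: "p * x + (1 - p) * y - \<eta> / 2 * v
        \<le> softmin \<eta> (A n + x) (B n + y) - softmin \<eta> (A n) (B n)"
      unfolding p(3) using \<eta> nonneg by (intro softmin_step) auto
    have "sqrt (ln 2) \<le> (1::real)"
      using ln_2_less_1 by simp
    then have "\<eta> * v \<le> c * (v / sqrt (V n))"
      using assms nonneg V mult_left_mono[of "sqrt (ln 2)" 1 "c * v"]
      by (simp add: rates real_sqrt_divide divide_simps mult_ac)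
    then have half: "\<eta> / 2 * v \<le> c * (v / sqrt (V n))"
      using nonneg \<eta> mult_nonneg_nonneg[of \<eta> v] by linarith
    have inc: "min (sqrt v) (v / sqrt (V n)) \<le> 3 * (sqrt (V n + v) - sqrt (V n))"
      using V nonneg by (intro min_le_sqrt_increment)
    have d: "0 \<le> sqrt (V n + v) - sqrt (V n)"
      using nonneg by simp
    have "p * x + (1 - p) * y - (softmin \<eta> (A n + x) (B n + y) - softmin \<eta> (A n) (B n))
        \<le> (3 + 3 * c) * (sqrt (V n + v) - sqrt (V n))"
    \<comment> \<open>If the new moment is large compared with the past, the rate was tuned too high
      for the quadratic bound; the mean loss is then paid by \<open>sqrt v\<close>, using only that
      the potential does not fall. Otherwise the quadratic bound applies.\<close>
    proof (cases "sqrt v \<le> v / sqrt (V n)")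
      case True
      then have "sqrt v \<le> 3 * (sqrt (V n + v) - sqrt (V n))"
        using inc by simp
      also have "\<dots> \<le> (3 + 3 * c) * (sqrt (V n + v) - sqrt (V n))"
        using d assms by (intro mult_right_mono) auto
      finally show ?thesis
        using mean mono by linarith
    next
      case False
      then have "c * (v / sqrt (V n)) \<le> c * (3 * (sqrt (V n + v) - sqrt (V n)))"
        using inc assms by (intro mult_left_mono) auto
      also have "\<dots> = (3 * c) * (sqrt (V n + v) - sqrt (V n))"
        by simp
      also have "\<dots> \<le> (3 + 3 * c) * (sqrt (V n + v) - sqrt (V n))"
        using d by (intro mult_right_mono) auto
      finally show ?thesis
        using step half by linarith
    qed
    moreover have "softmin \<eta> (A n + x) (B n + y) \<le> softmin \<eta>' (A n + x) (B n + y)"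
      using \<eta>' by (rule softmin_antimono)
    ultimately show ?thesis
      by linarith
  qed
  moreover have "L n \<le> softmin \<eta> (A n) (B n) + (3 + 3 * c) * sqrt (V n)"
    using Suc.IH by (simp add: L_def A_def B_def V_def \<eta>_def)
  ultimately have "L (Suc n) \<le> softmin \<eta>' (A (Suc n)) (B (Suc n)) + (3 + 3 * c) * sqrt (V (Suc n))"
    unfolding Suc_eqs right_diff_distrib by linarith
  then show ?case
    by (simp add: L_def A_def B_def V_def \<eta>'_def)
qed

text \<open>Both one-sided losses differ from the true ones by the same \<open>min\<close>, so
  regrets are unchanged. The final potential exceeds the smaller cumulative loss by at most
  \<open>ln 2 / \<eta>\<close>, which for the final rate is \<open>sqrt (ln 2 * V) / c\<close>; this
  is the source of \<open>1 / c\<close>.\<close>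

lemma mix_regret:
  assumes "c > 0"
  shows "(\<Sum>s=1..n. mix_weight c a b s * a s + (1 - mix_weight c a b s) * b s - a s)
      \<le> (3 + 3 * c + 1 / c) * sqrt (\<Sum>s=1..n. mix_var c a b s)" (is "?ra \<le> _")
    and "(\<Sum>s=1..n. mix_weight c a b s * a s + (1 - mix_weight c a b s) * b s - b s)
      \<le> (3 + 3 * c + 1 / c) * sqrt (\<Sum>s=1..n. mix_var c a b s)" (is "?rb \<le> _")
proof -
  define A B V where "A = (\<Sum>s=1..n. excess a b s)" and "B = (\<Sum>s=1..n. excess b a s)"
    and "V = (\<Sum>s=1..n. mix_var c a b s)"
  define L where
    "L = (\<Sum>s=1..n. mix_weight c a b s * excess a b s + (1 - mix_weight c a b s) * excess b a s)"
  have rewrite: "?ra = L - A" "?rb = L - B"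
    unfolding A_def B_def L_def sum_subtractf[symmetric]
    by (intro sum.cong; simp add: excess_def min.commute algebra_simps)+
  have nonneg: "0 \<le> A" "0 \<le> B" "0 \<le> V"
    by (simp_all add: A_def B_def V_def excess_nonneg mix_var_nonneg sum_nonneg)
  have pot: "L \<le> softmin (mix_rate c a b n) A B + (3 + 3 * c) * sqrt V"
    using mix_potential[OF assms] by (simp add: A_def B_def V_def L_def)
  have "softmin (mix_rate c a b n) A B \<le> min A B + 1 / c * sqrt V"
  proof (cases "V = 0")
    case True
    then have "\<forall>s\<in>{1..n}. mix_var c a b s = 0"
      unfolding V_def by (subst (asm) sum_nonneg_eq_0_iff) (auto simp: mix_var_nonneg)
    then have "A = 0" "B = 0"
      by (simp_all add: A_def B_def mix_var_eq_0_iff)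
    then show ?thesis
      using True by simp
  next
    case False
    then have V: "V > 0"
      using nonneg by simp
    have \<eta>: "mix_rate c a b n = c * sqrt (ln 2 / V)"
      by (simp add: mix_rate_def V_def)
    then have "mix_rate c a b n > 0"
      using V assms by simp
    then have "softmin (mix_rate c a b n) A B \<le> min A B + ln 2 / mix_rate c a b n"
      using softmin_le_left[of "mix_rate c a b n" A B] softmin_le_left[of "mix_rate c a b n" B A]
      by (simp add: softmin_commute[of _ B A] min_def)
    also have "ln 2 / mix_rate c a b n = 1 / c * (sqrt (ln 2) * sqrt V)"
      using assms V real_sqrt_mult_self[of "ln 2"]
      by (simp add: \<eta> real_sqrt_divide field_simps)
    also have "\<dots> \<le> 1 / c * (1 * sqrt V)"
      using assms nonneg ln_2_less_1 by (intro mult_left_mono mult_right_mono) auto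
    finally show ?thesis
      by simp
  qed
  then have "L - A \<le> (3 + 3 * c + 1 / c) * sqrt V" "L - B \<le> (3 + 3 * c + 1 / c) * sqrt V"
    using pot by (simp_all add: distrib_right)
  then show "?ra \<le> (3 + 3 * c + 1 / c) * sqrt (\<Sum>s=1..n. mix_var c a b s)"
    and "?rb \<le> (3 + 3 * c + 1 / c) * sqrt (\<Sum>s=1..n. mix_var c a b s)"
    unfolding rewrite V_def .
qed

section \<open>Projected subgradient steps in a segment\<close>

text \<open>Each summand is at most twice the increment of the square root of the partial sum, since
  \<open>Z\<^sup>2 - X\<^sup>2 = (Z - X) * (Z + X)\<close>. Leading zero terms are 0 / 0 and count
  as 0.\<close>

lemma sum_div_sqrt_partial_sums_le:
  fixes G :: "nat \<Rightarrow> real"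
  assumes "\<And>t. G t \<ge> 0"
  shows "(\<Sum>t=Suc s..e. G t / sqrt (\<Sum>\<tau>=Suc s..t. G \<tau>)) \<le> 2 * sqrt (\<Sum>t=Suc s..e. G t)"
proof (induction e)
  case 0
  then show ?case by simp
next
  case (Suc e)
  show ?case
  proof (cases "s \<le> e")
    case False
    then show ?thesis by simp
  next
    case True
    define S where "S = (\<Sum>t=Suc s..e. G t)"
    define X Z where "X = sqrt S" and "Z = sqrt (S + G (Suc e))"
    have nonneg: "S \<ge> 0" "G (Suc e) \<ge> 0"
      using assms by (simp_all add: S_def sum_nonneg)
    have XZ: "0 \<le> X" "X \<le> Z" and G: "G (Suc e) = Z\<^sup>2 - X\<^sup>2"
      using nonneg by (simp_all add: X_def Z_def)
    have "G (Suc e) / Z \<le> 2 * Z - 2 * X"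
    proof (cases "Z = 0")
      case True
      then show ?thesis
        using XZ by simp
    next
      case False
      have "G (Suc e) = (Z - X) * (Z + X)"
        by (simp add: G power2_eq_square algebra_simps)
      also have "\<dots> \<le> (Z - X) * (2 * Z)"
        using XZ by (intro mult_left_mono) auto
      finally have "G (Suc e) \<le> (2 * Z - 2 * X) * Z"
        by (simp add: algebra_simps)
      then show ?thesis
        using False XZ by (simp add: pos_divide_le_eq)
    qed
    then show ?thesis
      using Suc.IH True by (simp add: S_def[symmetric] X_def[symmetric] Z_def[symmetric])
  qed
qed

text \<open>Keeping the last distance on the right-hand side makes the bracket nonnegative, so that the
  weight \<open>h e\<close> can be raised to \<open>h (Suc e)\<close> in the induction.\<close>

lemma weighted_distance_telescope:
  fixes x u :: "nat \<Rightarrow> 'a::real_inner" and h :: "nat \<Rightarrow> real"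
  assumes "s < e"
    and h: "\<And>t. s < t \<Longrightarrow> t \<le> e \<Longrightarrow> 0 \<le> h t"
      "\<And>t. s < t \<Longrightarrow> t < e \<Longrightarrow> h t \<le> h (Suc t)"
    and D: "\<And>t t'. s < t \<Longrightarrow> s < t' \<Longrightarrow> t' \<le> e \<Longrightarrow> norm (x t - u t') \<le> D"
  shows "(\<Sum>t=Suc s..e. h t * ((norm (x t - u t))\<^sup>2 - (norm (x (Suc t) - u t))\<^sup>2))
    \<le> h e * (D\<^sup>2 + 2 * D * (\<Sum>t=Suc s..<e. norm (u (Suc t) - u t)) - (norm (x (Suc e) - u e))\<^sup>2)"
  using assms(1)[THEN Suc_leI] h D
proof (induction e rule: nat_induct_at_least)
  case base
  then have "(norm (x (Suc s) - u (Suc s)))\<^sup>2 \<le> D\<^sup>2"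
    by (intro power_mono) auto
  then show ?case
    using base(1)[of "Suc s"] by (simp add: mult_left_mono)
next
  case (Suc e)
  define B where "B = D\<^sup>2 + 2 * D * (\<Sum>t=Suc s..<e. norm (u (Suc t) - u t)) - (norm (x (Suc e) - u e))\<^sup>2"
  have le: "norm (x (Suc e) - u e) \<le> D" "norm (x (Suc e) - u (Suc e)) \<le> D"
    using Suc.prems(3) Suc.hyps by auto
  have D0: "D \<ge> 0"
    using le norm_ge_zero order_trans by blast
  have IH: "(\<Sum>t=Suc s..e. h t * ((norm (x t - u t))\<^sup>2 - (norm (x (Suc t) - u t))\<^sup>2)) \<le> h e * B"
    unfolding B_def by (rule Suc.IH) (use Suc.prems in auto)
  have "(norm (x (Suc e) - u e))\<^sup>2 \<le> D\<^sup>2"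
    using le by (intro power_mono) auto
  then have "B \<ge> 0"
    using D0 by (simp add: B_def add_increasing2 sum_nonneg le_diff_eq)
  then have "h e * B \<le> h (Suc e) * B"
    using Suc.prems(2)[of e] Suc.hyps by (intro mult_right_mono) auto
  \<comment> \<open>The price of moving the comparator inside the squared distance: a difference of
    squares, with the triangle inequality for one factor and \<open>2 * D\<close> for the
    other.\<close>
  moreover have "(norm (x (Suc e) - u (Suc e)))\<^sup>2 - (norm (x (Suc e) - u e))\<^sup>2
      \<le> 2 * D * norm (u (Suc e) - u e)"
  proof -
    define \<alpha> \<beta> \<gamma> where "\<alpha> = norm (x (Suc e) - u (Suc e))" and "\<beta> = norm (x (Suc e) - u e)"
      and "\<gamma> = norm (u (Suc e) - u e)"
    have "\<alpha> \<le> \<beta> + \<gamma>"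
      using norm_triangle_ineq4[of "x (Suc e) - u e" "u (Suc e) - u e"]
      by (simp add: \<alpha>_def \<beta>_def \<gamma>_def)
    moreover have bounds: "0 \<le> \<alpha>" "0 \<le> \<beta>" "0 \<le> \<gamma>" "\<alpha> \<le> D" "\<beta> \<le> D"
      using le by (simp_all add: \<alpha>_def \<beta>_def \<gamma>_def)
    ultimately have "(\<alpha> - \<beta>) * (\<alpha> + \<beta>) \<le> \<gamma> * (\<alpha> + \<beta>)"
      by (intro mult_right_mono) auto
    also have "\<dots> \<le> \<gamma> * (2 * D)"
      using bounds by (intro mult_left_mono) auto
    finally show ?thesis
      by (simp add: \<alpha>_def \<beta>_def \<gamma>_def power2_eq_square algebra_simps)
  qed
  then have "h (Suc e) * (B + ((norm (x (Suc e) - u (Suc e)))\<^sup>2 - (norm (x (Suc (Suc e)) - u (Suc e)))\<^sup>2))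
      \<le> h (Suc e) * (B + (2 * D * norm (u (Suc e) - u e) + (norm (x (Suc e) - u e))\<^sup>2
          - (norm (x (Suc (Suc e)) - u (Suc e)))\<^sup>2))"
    using Suc.prems(1)[of "Suc e"] Suc.hyps by (intro mult_left_mono) auto
  moreover have "B + (2 * D * norm (u (Suc e) - u e) + (norm (x (Suc e) - u e))\<^sup>2
          - (norm (x (Suc (Suc e)) - u (Suc e)))\<^sup>2)
      = D\<^sup>2 + 2 * D * (\<Sum>t=Suc s..<Suc e. norm (u (Suc t) - u t)) - (norm (x (Suc (Suc e)) - u (Suc e)))\<^sup>2"
    using Suc.hyps by (simp add: B_def distrib_left)
  ultimately show ?case
    using IH Suc.hyps by (simp add: distrib_left)
qed

lemma segment_eqI:
  assumes "1 \<le> k" "k \<le> m" "reset_time (k - 1) < t" "k < m \<Longrightarrow> t \<le> reset_time k"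
  shows "segment m t = k"
  unfolding segment_def
proof (rule Least_equality)
  show "k = m \<or> t \<le> reset_time k"
    using assms by linarith
next
  fix j
  assume j: "j = m \<or> t \<le> reset_time j"
  show "k \<le> j"
  proof (rule ccontr)
    assume "\<not> k \<le> j"
    then have "j \<le> k - 1" "j \<noteq> m"
      using assms by auto
    then have "reset_time j \<le> reset_time (k - 1)"
      by (simp add: reset_time_def diff_le_mono)
    then show False
      using j \<open>j \<noteq> m\<close> assms by linarith
  qed
qed

context
  fixes K :: "'a::euclidean_space set" and x1 :: 'a and g :: "nat \<Rightarrow> 'a" and D :: real
  assumes K: "convex K" "closed K" "bounded K" "x1 \<in> K" and D: "D = diameter K" "D > 0"
begin

lemma norm_diff_le_diameter: "x \<in> K \<Longrightarrow> y \<in> K \<Longrightarrow> norm (x - y) \<le> D"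
  using diameter_bounded_bound[OF K(3), of x y] by (simp add: D dist_norm)

lemma run_in: "run K x1 g m t \<in> K"
  using K by (induction t) (auto intro!: closest_point_in_set)

text \<open>The projection is nonexpansive and fixes \<open>u\<close>; expanding the squared
  distance then isolates the inner product.\<close>

lemma run_step:
  assumes "t \<ge> 1" "u \<in> K" "g t \<noteq> 0" "\<eta> = step_size D g m t" "\<eta> > 0"
  shows "g t \<bullet> (run K x1 g m t - u)
    \<le> ((norm (run K x1 g m t - u))\<^sup>2 - (norm (run K x1 g m (Suc t) - u))\<^sup>2) / (2 * \<eta>)
       + \<eta> / 2 * (norm (g t))\<^sup>2"
proof -
  define z where "z = run K x1 g m t - u"
  have "run K x1 g m (Suc t) = closest_point K (run K x1 g m t - \<eta> *\<^sub>R g t)"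
    using assms by (simp add: D)
  then have "norm (run K x1 g m (Suc t) - u) \<le> norm (z - \<eta> *\<^sub>R g t)"
    using closest_point_lipschitz[OF K(1,2), of "run K x1 g m t - \<eta> *\<^sub>R g t" u] assms(2)
    by (auto simp: closest_point_self dist_norm z_def algebra_simps)
  then have "(norm (run K x1 g m (Suc t) - u))\<^sup>2 \<le> (norm (z - \<eta> *\<^sub>R g t))\<^sup>2"
    by (intro power_mono) auto
  also have "\<dots> = (norm z)\<^sup>2 - 2 * \<eta> * (g t \<bullet> z) + \<eta>\<^sup>2 * (norm (g t))\<^sup>2"
    unfolding power2_norm_eq_inner
    by (simp add: inner_diff_left inner_diff_right inner_commute power2_eq_square algebra_simps)
  finally have "2 * \<eta> * (g t \<bullet> z) \<le> (norm z)\<^sup>2 - (norm (run K x1 g m (Suc t) - u))\<^sup>2 + \<eta>\<^sup>2 * (norm (g t))\<^sup>2"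
    by linarith
  then have "g t \<bullet> z \<le> ((norm z)\<^sup>2 - (norm (run K x1 g m (Suc t) - u))\<^sup>2 + \<eta>\<^sup>2 * (norm (g t))\<^sup>2) / (2 * \<eta>)"
    using assms by (simp add: pos_le_divide_eq mult_ac)
  also have "\<dots> = ((norm z)\<^sup>2 - (norm (run K x1 g m (Suc t) - u))\<^sup>2) / (2 * \<eta>) + \<eta> / 2 * (norm (g t))\<^sup>2"
    using assms by (simp add: add_divide_distrib power2_eq_square)
  finally show ?thesis
    by (simp add: z_def)
qed

text \<open>The step size balances the distance terms against the squared-norm terms: each
  contributes \<open>D * sqrt q * sqrt (S e)\<close>. The iterate at the start of the segment may be
  any point of \<open>K\<close>, so a reset can keep it.\<close>

lemma segment_regret:
  assumes "1 \<le> k" "s = reset_time (k - 1)" "s \<le> e"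
    and seg: "\<And>t. s < t \<Longrightarrow> t \<le> e \<Longrightarrow> segment m t = k"
    and u: "\<And>t. s < t \<Longrightarrow> t \<le> e \<Longrightarrow> u t \<in> K"
    and path: "(\<Sum>t=Suc s..<e. norm (u (Suc t) - u t)) \<le> path_budget D k"
  shows "(\<Sum>t=Suc s..e. g t \<bullet> (run K x1 g m t - u t))
    \<le> 2 * D * sqrt (2 ^ (k - 1)) * sqrt (\<Sum>t=Suc s..e. (norm (g t))\<^sup>2)"
proof (cases "s = e")
  case True
  then show ?thesis by simp
next
  case False
  then have "s < e"
    using assms by simp
  \<comment> \<open>This is \<open>path_budget D k / D + 1 / 2\<close>, chosen so that
    \<open>D\<^sup>2 + 2 * D * path_budget D k\<close> equals
    \<open>2 * D\<^sup>2 * q\<close>.\<close>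
  define q :: real where "q = 2 ^ (k - 1) - 1 / 2"
  define S where "S = (\<lambda>t. \<Sum>\<tau>=Suc s..t. (norm (g \<tau>))\<^sup>2)"
  define \<eta> h where "\<eta> = (\<lambda>t. D * sqrt q / sqrt (S t))" and "h = (\<lambda>t. sqrt (S t) / (2 * (D * sqrt q)))"
  define x where "x = run K x1 g m"
  have "(1::real) \<le> 2 ^ (k - 1)"
    by simp
  then have q: "q > 0" "q \<le> 2 ^ (k - 1)"
    unfolding q_def by linarith+
  have S0: "S t \<ge> 0" for t
    by (simp add: S_def sum_nonneg)
  have step_size: "step_size D g m t = \<eta> t" if "s < t" "t \<le> e" for t
    using D(2) assms(2) seg[OF that] by (simp add: step_size_def \<eta>_def q_def S_def path_budget_def Let_def)
  have round: "g t \<bullet> (x t - u t) \<le> h t * ((norm (x t - u t))\<^sup>2 - (norm (x (Suc t) - u t))\<^sup>2)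
      + D * sqrt q / 2 * ((norm (g t))\<^sup>2 / sqrt (S t))" if t: "s < t" "t \<le> e" for t
  \<comment> \<open>A zero subgradient leaves the iterate in place, and both sides vanish. Otherwise
    \<open>S t\<close> is positive, so the step size is a genuine positive number and
    \<open>h t\<close> is the reciprocal of twice it.\<close>
  proof (cases "g t = 0")
    case True
    then show ?thesis
      using t by (simp add: x_def)
  next
    case False
    have "(norm (g t))\<^sup>2 \<le> S t"
      unfolding S_def using t by (intro member_le_sum) auto
    then have "S t > 0"
      using False by (smt (verit) zero_less_norm_iff zero_less_power)
    then have \<eta>: "\<eta> t > 0" "1 / (2 * \<eta> t) = h t"
      using D q by (auto simp: \<eta>_def h_def)
    show ?thesis
      using run_step[of t "u t" "\<eta> t" m] False t u[OF t] step_size[OF t] \<eta>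
      by (simp add: x_def \<eta>_def h_def mult_ac)
  qed
  have "(\<Sum>t=Suc s..e. g t \<bullet> (x t - u t))
      \<le> (\<Sum>t=Suc s..e. h t * ((norm (x t - u t))\<^sup>2 - (norm (x (Suc t) - u t))\<^sup>2)
          + D * sqrt q / 2 * ((norm (g t))\<^sup>2 / sqrt (S t)))"
    using round by (intro sum_mono) auto
  also have "\<dots> = (\<Sum>t=Suc s..e. h t * ((norm (x t - u t))\<^sup>2 - (norm (x (Suc t) - u t))\<^sup>2))
      + D * sqrt q / 2 * (\<Sum>t=Suc s..e. (norm (g t))\<^sup>2 / sqrt (S t))"
    by (simp add: sum.distrib sum_distrib_left)
  also have "\<dots> \<le> D * sqrt q * sqrt (S e) + D * sqrt q * sqrt (S e)"
  proof (rule add_mono)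
    have "(\<Sum>t=Suc s..e. h t * ((norm (x t - u t))\<^sup>2 - (norm (x (Suc t) - u t))\<^sup>2))
        \<le> h e * (D\<^sup>2 + 2 * D * (\<Sum>t=Suc s..<e. norm (u (Suc t) - u t)) - (norm (x (Suc e) - u e))\<^sup>2)"
    proof (rule weighted_distance_telescope[OF \<open>s < e\<close>])
      show "0 \<le> h t" for t
        using D q S0 by (simp add: h_def)
      show "h t \<le> h (Suc t)" if "s < t" for t
        using D q that by (simp add: h_def S_def divide_right_mono)
      show "norm (x t - u t') \<le> D" if "s < t'" "t' \<le> e" for t t'
        unfolding x_def by (intro norm_diff_le_diameter run_in u that)
    qed
    also have "\<dots> \<le> h e * (2 * D\<^sup>2 * q)"
    proof (rule mult_left_mono)
      have "2 * D * (\<Sum>t=Suc s..<e. norm (u (Suc t) - u t)) \<le> 2 * D * path_budget D k"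
        using path D(2) by (intro mult_left_mono) auto
      also have "\<dots> = 2 * D\<^sup>2 * q - D\<^sup>2"
        by (simp add: path_budget_def q_def power2_eq_square algebra_simps)
      finally show "D\<^sup>2 + 2 * D * (\<Sum>t=Suc s..<e. norm (u (Suc t) - u t)) - (norm (x (Suc e) - u e))\<^sup>2
          \<le> 2 * D\<^sup>2 * q"
        using zero_le_power2[of "norm (x (Suc e) - u e)"] by linarith
    qed (use D q S0 in \<open>simp add: h_def\<close>)
    also have "\<dots> = D * sqrt q * sqrt (S e)"
      using D q by (simp add: h_def power2_eq_square real_div_sqrt field_simps)
    finally show "(\<Sum>t=Suc s..e. h t * ((norm (x t - u t))\<^sup>2 - (norm (x (Suc t) - u t))\<^sup>2))
        \<le> D * sqrt q * sqrt (S e)" .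
    have "(\<Sum>t=Suc s..e. (norm (g t))\<^sup>2 / sqrt (S t)) \<le> 2 * sqrt (S e)"
      unfolding S_def by (rule sum_div_sqrt_partial_sums_le) simp
    then have "D * sqrt q / 2 * (\<Sum>t=Suc s..e. (norm (g t))\<^sup>2 / sqrt (S t))
        \<le> D * sqrt q / 2 * (2 * sqrt (S e))"
      using D q by (intro mult_left_mono) auto
    then show "D * sqrt q / 2 * (\<Sum>t=Suc s..e. (norm (g t))\<^sup>2 / sqrt (S t)) \<le> D * sqrt q * sqrt (S e)"
      by simp
  qed
  also have "\<dots> = 2 * D * sqrt q * sqrt (S e)"
    by simp
  also have "\<dots> \<le> 2 * D * sqrt (2 ^ (k - 1)) * sqrt (S e)"
    using D q S0 by (intro mult_right_mono mult_left_mono real_sqrt_le_mono) auto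
  finally show ?thesis
    by (simp add: x_def S_def)
qed

section \<open>Regret of a run over all its segments\<close>

lemma run_regret:
  assumes "1 \<le> m"
    and u: "\<And>t. 1 \<le> t \<Longrightarrow> t \<le> T \<Longrightarrow> u t \<in> K"
    and path: "(\<Sum>t=1..<T. norm (u (Suc t) - u t)) \<le> path_budget D m"
  shows "(\<Sum>t=1..T. g t \<bullet> (run K x1 g m t - u t))
    \<le> 6 * D * sqrt (2 ^ m) * sqrt (\<Sum>t=1..T. (norm (g t))\<^sup>2)"
proof -
  define G where "G = (\<Sum>t=1..T. (norm (g t))\<^sup>2)"
  \<comment> \<open>The end of segment \<open>j\<close>, cut off at the horizon; the last segment
    \<open>m\<close> always ends at \<open>T\<close>.\<close>
  define e where "e = (\<lambda>j. if j < m then min T (reset_time j) else T)"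
  define R where "R = (\<lambda>n. \<Sum>t=1..n. g t \<bullet> (run K x1 g m t - u t))"
  have "R (e j) \<le> 6 * D * sqrt (2 ^ j) * sqrt G" if "j \<le> m" for j
    using that
  proof (induction j)
    case 0
    then show ?case
      using assms(1) D by (simp add: e_def R_def reset_time_def G_def sum_nonneg)
  next
    case (Suc j)
    have IH: "R (e j) \<le> 6 * D * sqrt (2 ^ j) * sqrt G"
      using Suc by simp
    \<comment> \<open>The constant 6 closes the induction: a further segment adds 2, and
      \<open>6 + 2 = 6 * (4 / 3) \<le> 6 * sqrt 2\<close>.\<close>
    have sqrt2: "(4 / 3 :: real) \<le> sqrt 2"
      by (rule real_le_rsqrt) (simp add: power2_eq_square)
    have G0: "G \<ge> 0"
      by (simp add: G_def sum_nonneg)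
    have "R (e (Suc j)) \<le> R (e j) + 2 * D * sqrt (2 ^ j) * sqrt G"
    proof (cases "T \<le> reset_time j")
      case True
      also have "reset_time j \<le> reset_time (Suc j)"
        by (simp add: reset_time_def)
      finally have "e (Suc j) = e j"
        using True Suc.prems by (simp add: e_def)
      then show ?thesis
        using D G0 by simp
    next
      case False
      then have ej: "e j = reset_time j" "e j \<le> e (Suc j)" "e (Suc j) \<le> T"
        using Suc.prems by (auto simp: e_def reset_time_def)
      have seg: "segment m t = Suc j" if "e j < t" "t \<le> e (Suc j)" for t
        using that Suc.prems ej by (intro segment_eqI) (auto simp: e_def)
      have "(\<Sum>t=Suc (e j)..<e (Suc j). norm (u (Suc t) - u t)) \<le> path_budget D (Suc j)"
      proof (cases "Suc j < m")
        case True
        then have "e (Suc j) \<le> 2 * 2 ^ j - 1"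
          by (simp add: e_def reset_time_def)
        \<comment> \<open>Segment \<open>Suc j\<close> has at most \<open>2 ^ j\<close> rounds,
          hence at most \<open>2 ^ j - 1\<close> comparator moves of length at most
          \<open>D\<close>: exactly \<open>path_budget D (Suc j)\<close>.\<close>
        then have len: "e (Suc j) - Suc (e j) \<le> 2 ^ j - 1"
          unfolding ej(1) by (simp add: reset_time_def)
        have "(\<Sum>t=Suc (e j)..<e (Suc j). norm (u (Suc t) - u t)) \<le> (\<Sum>t=Suc (e j)..<e (Suc j). D)"
          using ej by (intro sum_mono norm_diff_le_diameter u) auto
        also have "\<dots> = D * real (e (Suc j) - Suc (e j))"
          by simp
        also have "\<dots> \<le> D * real (2 ^ j - 1)"
          using D len by (intro mult_left_mono) (auto simp only: of_nat_le_iff)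
        finally show ?thesis
          by (simp add: path_budget_def of_nat_diff)
      next
        case False
        then have "Suc j = m"
          using Suc.prems by simp
        have "(\<Sum>t=Suc (e j)..<e (Suc j). norm (u (Suc t) - u t)) \<le> (\<Sum>t=1..<T. norm (u (Suc t) - u t))"
          using ej by (intro sum_mono2) auto
        then show ?thesis
          using path \<open>Suc j = m\<close> by simp
      qed
      then have "(\<Sum>t=Suc (e j)..e (Suc j). g t \<bullet> (run K x1 g m t - u t))
          \<le> 2 * D * sqrt (2 ^ j) * sqrt (\<Sum>t=Suc (e j)..e (Suc j). (norm (g t))\<^sup>2)"
        using segment_regret[of "Suc j" "e j" "e (Suc j)" m u] ej seg u by simp
      also have "\<dots> \<le> 2 * D * sqrt (2 ^ j) * sqrt G"
        unfolding G_def using D ej by (intro mult_left_mono real_sqrt_le_mono sum_mono2) auto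
      finally have "(\<Sum>t=Suc (e j)..e (Suc j). g t \<bullet> (run K x1 g m t - u t)) \<le> 2 * D * sqrt (2 ^ j) * sqrt G" .
      moreover have "R (e (Suc j)) = R (e j) + (\<Sum>t=Suc (e j)..e (Suc j). g t \<bullet> (run K x1 g m t - u t))"
        unfolding R_def using sum.ub_add_nat[of 1 "e j" _ "e (Suc j) - e j"] ej(2) by simp
      ultimately show ?thesis
        by simp
    qed
    also have "\<dots> \<le> 8 * D * sqrt (2 ^ j) * sqrt G"
      using IH by linarith
    also have "\<dots> = (6 * D * sqrt (2 ^ j) * sqrt G) * (4 / 3)"
      by simp
    also have "\<dots> \<le> (6 * D * sqrt (2 ^ j) * sqrt G) * sqrt 2"
      using D G0 sqrt2 by (intro mult_left_mono) auto
    also have "\<dots> = 6 * D * sqrt (2 ^ Suc j) * sqrt G"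
      by (simp add: real_sqrt_mult)
    finally show ?case .
  qed
  from this[of m] show ?thesis
    by (simp add: e_def R_def G_def)
qed

section \<open>The recursive mixture\<close>

text \<open>While the runs coincide both experts are the same point, so mixing them changes nothing
  and the recursion holds without the branching test that makes it terminate.\<close>

lemma mixture_eq:
  "mixture c K x1 g k t =
    (let p = mix_weight c (\<lambda>s. g s \<bullet> run K x1 g (Suc k) s) (\<lambda>s. g s \<bullet> mixture c K x1 g (Suc k) s) t
     in p *\<^sub>R run K x1 g (Suc k) t + (1 - p) *\<^sub>R mixture c K x1 g (Suc k) t)"
proof (cases "runs_coincide K x1 g (Suc k) t")
  case True
  have all: "run K x1 g j s = run K x1 g (Suc k) s" if "Suc k \<le> j" "s \<le> t" for j s
    using True that unfolding runs_coincide_def by blast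
  have "runs_coincide K x1 g (Suc (Suc k)) t"
    unfolding runs_coincide_def
  proof (intro allI impI)
    fix j s
    assume "Suc (Suc k) \<le> j" "s \<le> t"
    then show "run K x1 g j s = run K x1 g (Suc (Suc k)) s"
      using all[of j s] all[of "Suc (Suc k)" s] by simp
  qed
  then have "mixture c K x1 g (Suc k) t = run K x1 g (Suc k) t"
    using all[of "Suc (Suc k)" t] by (subst mixture.simps) simp
  moreover have "mixture c K x1 g k t = run K x1 g (Suc k) t"
    using True by (subst mixture.simps) simp
  ultimately show ?thesis
    by (simp only: Let_def) (simp add: scaleR_left_diff_distrib)
next
  case False
  then show ?thesis
    by (subst mixture.simps) (simp only: if_False)
qed

lemma mixture_in: "mixture c K x1 g k t \<in> K"
proof (induction "t - k" arbitrary: k rule: less_induct)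
  case less
  show ?case
  proof (cases "runs_coincide K x1 g (Suc k) t")
    case True
    then show ?thesis
      by (subst mixture.simps) (simp add: run_in)
  next
    case False
    then have "mixture c K x1 g (Suc k) t \<in> K"
      using not_runs_coincide_less[OF False] by (intro less) simp
    then show ?thesis
      unfolding mixture_eq[of c k] Let_def
      using convexD[OF K(1) run_in] mix_weight_bounds by (simp add: less_imp_le)
  qed
qed

text \<open>Both experts lie in \<open>K\<close>, so by Cauchy-Schwarz each one-sided loss is at
  most \<open>D * norm (g t)\<close>, and the weighted second moment is at most its square.\<close>

lemma mixture_regret:
  assumes "c > 0"
  defines "C \<equiv> 3 + 3 * c + 1 / c"
  shows "(\<Sum>t=1..T. g t \<bullet> (mixture c K x1 g k t - run K x1 g (Suc k) t))
      \<le> C * D * sqrt (\<Sum>t=1..T. (norm (g t))\<^sup>2)"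
    and "(\<Sum>t=1..T. g t \<bullet> (mixture c K x1 g k t - mixture c K x1 g (Suc k) t))
      \<le> C * D * sqrt (\<Sum>t=1..T. (norm (g t))\<^sup>2)"
proof -
  define G where "G = (\<Sum>t=1..T. (norm (g t))\<^sup>2)"
  define a b where "a = (\<lambda>t. g t \<bullet> run K x1 g (Suc k) t)" and "b = (\<lambda>t. g t \<bullet> mixture c K x1 g (Suc k) t)"
  have loss: "g t \<bullet> mixture c K x1 g k t = mix_weight c a b t * a t + (1 - mix_weight c a b t) * b t" for t
    unfolding mixture_eq[of c k] a_def b_def by (simp add: Let_def inner_add_right)
  have var: "mix_var c a b t \<le> D\<^sup>2 * (norm (g t))\<^sup>2" for t
  proof -
    have "\<bar>a t - b t\<bar> \<le> norm (g t) * norm (run K x1 g (Suc k) t - mixture c K x1 g (Suc k) t)"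
      unfolding a_def b_def inner_diff_right[symmetric] by (rule Cauchy_Schwarz_ineq2)
    also have "\<dots> \<le> norm (g t) * D"
      by (intro mult_left_mono norm_diff_le_diameter run_in mixture_in) simp
    finally have "excess a b t \<le> norm (g t) * D" "excess b a t \<le> norm (g t) * D"
      using D by (auto simp: excess_def min_def)
    then have "(excess a b t)\<^sup>2 \<le> (norm (g t) * D)\<^sup>2" "(excess b a t)\<^sup>2 \<le> (norm (g t) * D)\<^sup>2"
      by (auto intro!: power_mono simp: excess_nonneg)
    then have "mix_var c a b t \<le> mix_weight c a b t * (norm (g t) * D)\<^sup>2
        + (1 - mix_weight c a b t) * (norm (g t) * D)\<^sup>2"
      unfolding mix_var_def using mix_weight_bounds[where c = c and a = a and b = b and t = t]
      by (intro add_mono mult_left_mono) auto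
    also have "\<dots> = D\<^sup>2 * (norm (g t))\<^sup>2"
      by (simp add: power_mult_distrib algebra_simps)
    finally show ?thesis .
  qed
  have "sqrt (\<Sum>t=1..T. mix_var c a b t) \<le> sqrt (D\<^sup>2 * G)"
    unfolding G_def sum_distrib_left by (intro real_sqrt_le_mono sum_mono var)
  then have "C * sqrt (\<Sum>t=1..T. mix_var c a b t) \<le> C * (D * sqrt G)"
    using assms(1) D by (intro mult_left_mono) (auto simp: C_def real_sqrt_mult)
  then show "(\<Sum>t=1..T. g t \<bullet> (mixture c K x1 g k t - run K x1 g (Suc k) t))
      \<le> C * D * sqrt (\<Sum>t=1..T. (norm (g t))\<^sup>2)"
    and "(\<Sum>t=1..T. g t \<bullet> (mixture c K x1 g k t - mixture c K x1 g (Suc k) t))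
      \<le> C * D * sqrt (\<Sum>t=1..T. (norm (g t))\<^sup>2)"
    using mix_regret[OF assms(1), of a b T]
    unfolding inner_diff_right loss G_def[symmetric] C_def[symmetric]
    by (simp_all add: a_def b_def mult_ac)
qed

text \<open>Telescoping through \<open>k\<close> nested mixtures and then one last step to the run
  itself gives \<open>Suc k\<close> equal charges.\<close>

lemma decision_regret_run:
  assumes "c > 0"
  shows "(\<Sum>t=1..T. g t \<bullet> (decision c K x1 g t - run K x1 g (Suc k) t))
      \<le> real (Suc k) * ((3 + 3 * c + 1 / c) * D * sqrt (\<Sum>t=1..T. (norm (g t))\<^sup>2))"
proof -
  define B where "B = (3 + 3 * c + 1 / c) * D * sqrt (\<Sum>t=1..T. (norm (g t))\<^sup>2)"
  have chain: "(\<Sum>t=1..T. g t \<bullet> (x t - z t))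
      = (\<Sum>t=1..T. g t \<bullet> (x t - y t)) + (\<Sum>t=1..T. g t \<bullet> (y t - z t))" for x y z
    by (simp add: inner_diff_right flip: sum.distrib)
  have "(\<Sum>t=1..T. g t \<bullet> (decision c K x1 g t - mixture c K x1 g k t)) \<le> real k * B" for k
  proof (induction k)
    case 0
    then show ?case
      by (simp add: decision_def)
  next
    case (Suc k)
    have "real (Suc k) * B = real k * B + B"
      by (simp add: distrib_right)
    then show ?case
      using Suc mixture_regret(2)[OF assms, of k T]
      unfolding chain[of "decision c K x1 g" "mixture c K x1 g (Suc k)" "mixture c K x1 g k"] B_def by linarith
  qed
  from this[of k] show ?thesis
    using mixture_regret(1)[OF assms, of k T]
    unfolding chain[of "decision c K x1 g" "run K x1 g (Suc k)" "mixture c K x1 g k"] B_def[symmetric]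
    by (simp add: distrib_right)
qed

section \<open>Dynamic regret of the final decision\<close>

lemma dynamic_regret_linear:
  assumes "c > 0"
    and u: "\<And>t. 1 \<le> t \<Longrightarrow> t \<le> T \<Longrightarrow> u t \<in> K"
    and path: "(\<Sum>t=1..<T. norm (u (Suc t) - u t)) \<le> P"
  shows "(\<Sum>t=1..T. g t \<bullet> (decision c K x1 g t - u t))
    \<le> (12 + 6 * (3 + 3 * c + 1 / c)) * sqrt (D * (P + D) * (\<Sum>t=1..T. (norm (g t))\<^sup>2))"
proof -
  define G where "G = (\<Sum>t=1..T. (norm (g t))\<^sup>2)"
  define C where "C = 3 + 3 * c + 1 / c"
  \<comment> \<open>The condition says that \<open>path_budget D (Suc n)\<close> covers
    \<open>P\<close>, so run \<open>Suc n\<close> is the one to compare with.\<close>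
  define n where "n = (LEAST n. P / D + 1 \<le> 2 ^ n)"
  have P: "P \<ge> 0"
    using path sum_nonneg[of "{1..<T}" "\<lambda>t. norm (u (Suc t) - u t)"] by simp
  have G: "G \<ge> 0"
    by (simp add: G_def sum_nonneg)
  have C: "C > 0"
    using assms(1) by (simp add: C_def add_pos_pos)
  have "\<exists>n. P / D + 1 \<le> 2 ^ n"
    using real_arch_pow[of 2 "P / D + 1"] by (auto intro: less_imp_le)
  then have n: "P / D + 1 \<le> 2 ^ n"
    unfolding n_def by (rule LeastI_ex)
  \<comment> \<open>Minimality gives the converse up to a factor 2; for \<open>n = 0\<close> it
    follows from \<open>P \<ge> 0\<close>.\<close>
  have n': "2 ^ n \<le> 2 * (P / D + 1)"
  proof (cases n)
    case 0
    then show ?thesis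
      using P D by (simp add: add_increasing)
  next
    case (Suc j)
    then have "\<not> P / D + 1 \<le> 2 ^ j"
      unfolding n_def by (intro not_less_Least) simp
    then show ?thesis
      using Suc by simp
  qed
  have "P \<le> path_budget D (Suc n)"
    using n D(2) by (simp add: path_budget_def field_simps)
  then have run: "(\<Sum>t=1..T. g t \<bullet> (run K x1 g (Suc n) t - u t)) \<le> 6 * D * sqrt (2 ^ Suc n) * sqrt G"
    unfolding G_def using path by (intro run_regret u) auto
  have sqrt2: "(4 / 3 :: real) \<le> sqrt 2"
    by (rule real_le_rsqrt) (simp add: power2_eq_square)
  \<comment> \<open>Bernoulli's inequality absorbs the number of mixtures, linear in
    \<open>n\<close>, into the exponentially growing factor of the regret of the run.\<close>
  have "1 + real (Suc n) * (sqrt 2 - 1) \<le> sqrt (2 ^ Suc n)"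
    using Bernoulli_inequality[of "sqrt 2 - 1" "Suc n"] by (simp add: real_sqrt_power del: power_Suc)
  moreover have "real (Suc n) * (1 / 3) \<le> real (Suc n) * (sqrt 2 - 1)"
    using sqrt2 by (intro mult_left_mono) auto
  ultimately have "real (Suc n) * (1 / 3) \<le> sqrt (2 ^ Suc n)"
    by (smt (verit))
  then have lin: "real (Suc n) \<le> 3 * sqrt (2 ^ Suc n)"
    by (simp add: field_simps del: of_nat_Suc power_Suc)
  have "sqrt (2 ^ Suc n) \<le> sqrt (2\<^sup>2 * (P / D + 1))"
    using n' by (intro real_sqrt_le_mono) simp
  also have "\<dots> = 2 * sqrt (P / D + 1)"
    unfolding real_sqrt_mult by simp
  finally have "D * sqrt (2 ^ Suc n) \<le> D * (2 * sqrt (P / D + 1))"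
    using D(2) by (intro mult_left_mono) auto
  also have "\<dots> = 2 * sqrt (D\<^sup>2 * (P / D + 1))"
    unfolding real_sqrt_mult using D(2) by simp
  also have "D\<^sup>2 * (P / D + 1) = D * (P + D)"
    using D(2) by (simp add: field_simps power2_eq_square)
  finally have scale: "D * sqrt (2 ^ Suc n) \<le> 2 * sqrt (D * (P + D))" .
  have "(\<Sum>t=1..T. g t \<bullet> (decision c K x1 g t - u t))
      = (\<Sum>t=1..T. g t \<bullet> (decision c K x1 g t - run K x1 g (Suc n) t))
        + (\<Sum>t=1..T. g t \<bullet> (run K x1 g (Suc n) t - u t))"
    by (simp add: inner_diff_right flip: sum.distrib)
  also have "\<dots> \<le> real (Suc n) * (C * D * sqrt G) + 6 * D * sqrt (2 ^ Suc n) * sqrt G"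
    using decision_regret_run[OF assms(1), of n T] run by (simp only: C_def G_def add_mono)
  also have "\<dots> \<le> 3 * sqrt (2 ^ Suc n) * (C * D * sqrt G) + 6 * D * sqrt (2 ^ Suc n) * sqrt G"
    using lin C D G by (intro add_right_mono mult_right_mono) auto
  \<comment> \<open>The run contributes 6 and the mixtures \<open>3 * C\<close>; the factor 2 in
    \<open>scale\<close> turns them into \<open>12 + 6 * C\<close>.\<close>
  also have "\<dots> = (D * sqrt (2 ^ Suc n)) * ((6 + 3 * C) * sqrt G)"
    by (simp add: algebra_simps)
  also have "\<dots> \<le> (2 * sqrt (D * (P + D))) * ((6 + 3 * C) * sqrt G)"
    using scale C G by (intro mult_right_mono) auto
  also have "\<dots> = (12 + 6 * C) * sqrt (D * (P + D) * G)"
    unfolding real_sqrt_mult[of _ G] by (simp add: distrib_left distrib_right)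
  finally show ?thesis
    by (simp add: C_def G_def)
qed

end

text \<open>The constant depends only on the tuning constant \<open>c\<close> of the mixing rate,
  being chosen before the set, the starting point and the horizon. A fixed sequence \<open>g\<close>
  models adaptively received subgradients, because \<open>decision\<close> at round \<open>t\<close>
  depends only on earlier values of \<open>g\<close>.\<close>

theorem theorem5:
  fixes c :: real
  assumes "c > 0"
  shows "\<exists>C\<^sub>d :: real.
    \<forall>(K :: 'a::euclidean_space set) (x1 :: 'a).
      K \<noteq> {} \<and> convex K \<and> closed K \<and> bounded K \<and> diameter K > 0 \<and> x1 \<in> K \<longrightarrow>
      (\<forall>(T :: nat) (f :: nat \<Rightarrow> 'a \<Rightarrow> real) (g :: nat \<Rightarrow> 'a).
        T \<ge> 1 \<and>
        (\<forall>t\<in>{1..T}. convex_on K (f t) \<and>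
                    g t \<in> subdifferential K (f t) (decision c K x1 g t)) \<longrightarrow>
        (\<forall>(xs :: nat \<Rightarrow> 'a) (P :: real).
          (\<forall>t\<in>{1..T}. xs t \<in> K) \<and> (\<Sum>t\<in>{1..<T}. norm (xs (t + 1) - xs t)) \<le> P \<longrightarrow>
          (\<Sum>t = 1..T. f t (decision c K x1 g t) - f t (xs t))
            \<le> C\<^sub>d * sqrt (diameter K * (P + diameter K) * (\<Sum>t = 1..T. (norm (g t))\<^sup>2))))"
proof (intro exI allI impI, elim conjE)
  fix K :: "'a set" and x1 :: 'a and T :: nat and f :: "nat \<Rightarrow> 'a \<Rightarrow> real" and g xs :: "nat \<Rightarrow> 'a"
    and P :: real
  assume K: "convex K" "closed K" "bounded K" "x1 \<in> K" "diameter K > 0"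
    and g: "\<forall>t\<in>{1..T}. convex_on K (f t) \<and> g t \<in> subdifferential K (f t) (decision c K x1 g t)"
    and xs: "\<forall>t\<in>{1..T}. xs t \<in> K" and P: "(\<Sum>t\<in>{1..<T}. norm (xs (t + 1) - xs t)) \<le> P"
  \<comment> \<open>The subgradient inequality, with the comparator as test point, passes to the
    linear losses.\<close>
  have "(\<Sum>t = 1..T. f t (decision c K x1 g t) - f t (xs t))
      \<le> (\<Sum>t = 1..T. g t \<bullet> (decision c K x1 g t - xs t))"
    using g xs by (intro sum_mono) (auto simp: subdifferential_def)
  also have "\<dots> \<le> (12 + 6 * (3 + 3 * c + 1 / c))
      * sqrt (diameter K * (P + diameter K) * (\<Sum>t = 1..T. (norm (g t))\<^sup>2))"
    using K xs P assms by (intro dynamic_regret_linear) auto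
  finally show "(\<Sum>t = 1..T. f t (decision c K x1 g t) - f t (xs t))
      \<le> (12 + 6 * (3 + 3 * c + 1 / c))
        * sqrt (diameter K * (P + diameter K) * (\<Sum>t = 1..T. (norm (g t))\<^sup>2))" .
qed

end
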